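(* Let $\mathbf{C}$ be an even snowflake with $M$ edges. If $M\equiv 0\pmod 4$ then $\mathbf{C}$ is conservative; otherwise $\mathbf{C}$ is near-conservative.
   Context: A snowflake is the tree obtained from a disjoint union of stars $S_1,\ldots,S_p$ ($S_i\cong K_{1,n_i}$, $n_i\geq 3$) by identifying one leaf of each star into a single vertex $z$, the center. An internal vertex is a vertex of degree at least $2$. A snowflake is even if every internal vertex other than possibly the center has even degree. A labeling of a graph $G$ is a bijection from $E(G)$ to a set of $|E(G)|$ positive integers. Given an orientation and a labeling $\phi$, the vertex-sum $s(u)$ is the sum of labels of arcs entering $u$ minus the sum of labels of arcs leaving $u$. For $G$ with $M$ edges, a conservative labeling is an (orientation, labeling) pair with label set $[1,M]=\{1,\ldots,M\}$ such that $s(u)=0$ at every vertex of degree at least $3$; a near-conservative labeling is the same with label set $[1,M-1]\cup\{M+1\}$. $G$ is conservative if it admits a conservative labeling, and near-conservative if it is not conservative but admits a near-conservative labeling. *)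

theory Defs
  imports Main
begin

text \<open>Simple graphs: an edge is the two-element set of its end vertices.\<close>

record 'a sgraph =
  vertices :: "'a set"
  edges :: "'a set set"

definition degree :: "'a sgraph \<Rightarrow> 'a \<Rightarrow> nat" where
  "degree G v = card {e \<in> edges G. v \<in> e}"

definition is_leaf :: "'a sgraph \<Rightarrow> 'a \<Rightarrow> bool" where
  "is_leaf G v \<longleftrightarrow> v \<in> vertices G \<and> degree G v = 1"

definition internal :: "'a sgraph \<Rightarrow> 'a \<Rightarrow> bool" where
  "internal G v \<longleftrightarrow> v \<in> vertices G \<and> degree G v \<ge> 2"

text \<open>The star \<open>K\<^bsub>1,n\<^esub>\<close>, with hub \<open>0\<close>.\<close>

definition star :: "nat \<Rightarrow> nat sgraph" where
  "star n = \<lparr>vertices = {0..n}, edges = {{0, j} | j. j \<in> {1..n}}\<rparr>"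

definition disjoint_union :: "'a sgraph list \<Rightarrow> (nat \<times> 'a) sgraph" where
  "disjoint_union Gs =
    \<lparr>vertices = (\<Union>i < length Gs. Pair i ` vertices (Gs ! i)),
     edges = (\<Union>i < length Gs. (\<lambda>e. Pair i ` e) ` edges (Gs ! i))\<rparr>"

text \<open>\<open>G\<close> is, up to renaming of vertices, the graph obtained from \<open>H\<close> by identifying the
  vertices in \<open>L\<close> into the single vertex \<open>z\<close>; \<open>q\<close> is the quotient map.\<close>

definition identification ::
  "'b sgraph \<Rightarrow> 'b set \<Rightarrow> ('b \<Rightarrow> 'a) \<Rightarrow> 'a sgraph \<Rightarrow> 'a \<Rightarrow> bool" where
  "identification H L q G z \<longleftrightarrow>
     vertices G = q ` vertices H \<and>
     edges G = (\<lambda>e. q ` e) ` edges H \<and>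
     (\<forall>v \<in> vertices H. q v = z \<longleftrightarrow> v \<in> L) \<and>
     inj_on q (vertices H - L)"

definition snowflake :: "'a sgraph \<Rightarrow> 'a \<Rightarrow> bool" where
  "snowflake G z \<longleftrightarrow>
     (\<exists>ns l q. ns \<noteq> [] \<and>
        (\<forall>i < length ns. ns ! i \<ge> 3 \<and> is_leaf (star (ns ! i)) (l i)) \<and>
        identification (disjoint_union (map star ns)) {(i, l i) | i. i < length ns} q G z)"

definition even_snowflake :: "'a sgraph \<Rightarrow> 'a \<Rightarrow> bool" where
  "even_snowflake G z \<longleftrightarrow>
     snowflake G z \<and> (\<forall>v. internal G v \<and> v \<noteq> z \<longrightarrow> even (degree G v))"

text \<open>A pair \<open>(u, v)\<close> is an arc leaving \<open>u\<close> and entering \<open>v\<close>.\<close>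

definition orientation :: "'a sgraph \<Rightarrow> ('a \<times> 'a) set \<Rightarrow> bool" where
  "orientation G D \<longleftrightarrow>
     (\<forall>(u, v) \<in> D. {u, v} \<in> edges G) \<and>
     (\<forall>u v. {u, v} \<in> edges G \<longrightarrow> ((u, v) \<in> D) \<noteq> ((v, u) \<in> D))"

definition labeling :: "'a sgraph \<Rightarrow> ('a set \<Rightarrow> nat) \<Rightarrow> nat set \<Rightarrow> bool" where
  "labeling G \<phi> S \<longleftrightarrow>
     finite S \<and> card S = card (edges G) \<and> (\<forall>k \<in> S. k > 0) \<and> bij_betw \<phi> (edges G) S"

definition vertex_sum :: "('a \<times> 'a) set \<Rightarrow> ('a set \<Rightarrow> nat) \<Rightarrow> 'a \<Rightarrow> int" where
  "vertex_sum D \<phi> u =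
     (\<Sum>v | (v, u) \<in> D. int (\<phi> {v, u})) - (\<Sum>v | (u, v) \<in> D. int (\<phi> {u, v}))"

definition balanced_labeling ::
  "'a sgraph \<Rightarrow> nat set \<Rightarrow> ('a \<times> 'a) set \<Rightarrow> ('a set \<Rightarrow> nat) \<Rightarrow> bool" where
  "balanced_labeling G S D \<phi> \<longleftrightarrow>
     orientation G D \<and> labeling G \<phi> S \<and>
     (\<forall>u \<in> vertices G. degree G u \<ge> 3 \<longrightarrow> vertex_sum D \<phi> u = 0)"

definition conservative_labeling ::
  "'a sgraph \<Rightarrow> ('a \<times> 'a) set \<Rightarrow> ('a set \<Rightarrow> nat) \<Rightarrow> bool" where
  "conservative_labeling G = balanced_labeling G {1..card (edges G)}"

definition near_conservative_labeling ::
  "'a sgraph \<Rightarrow> ('a \<times> 'a) set \<Rightarrow> ('a set \<Rightarrow> nat) \<Rightarrow> bool" where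
  "near_conservative_labeling G =
     balanced_labeling G ({1..card (edges G) - 1} \<union> {card (edges G) + 1})"

definition conservative :: "'a sgraph \<Rightarrow> bool" where
  "conservative G \<longleftrightarrow> (\<exists>D \<phi>. conservative_labeling G D \<phi>)"

definition near_conservative :: "'a sgraph \<Rightarrow> bool" where
  "near_conservative G \<longleftrightarrow>
     \<not> conservative G \<and> (\<exists>D \<phi>. near_conservative_labeling G D \<phi>)"

end

theory Submission
  imports Defs "HOL-Combinatorics.Transposition"
begin

text \<open>
  Every edge meets exactly one hub, so a zero sum at all hubs makes the sum of all labels even;
  for \<open>M mod 4 = 2\<close> the sum of \<open>1, \<dots>, M\<close> is odd, which rules out conservative labelings.

  For the construction, let \<open>U m\<close> be \<open>[1,m]\<close> if \<open>4\<close> divides \<open>m\<close> and \<open>[1,m-1] \<union> {m+1}\<close> otherwise.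
  For even \<open>m\<close>, both \<open>U (m+4) - U m\<close> and \<open>U (m+6) - U m\<close> can be signed so that they sum to zero,
  hence so can \<open>U (m+n) - U m\<close> for every even \<open>n \<ge> 4\<close>. Stacking such blocks assigns a block to each
  star. Two consecutive blocks contain elements that differ by \<open>1\<close> and elements that differ by \<open>2\<close>.
  As the signs within a star may be reversed, pairing up the stars gives values \<open>\<plusminus>1\<close> or \<open>\<plusminus>2\<close> at the
  center for each pair, and with at least three stars these can be made to cancel.
\<close>

section \<open>Label sets and signs that sum to zero\<close>

definition labels :: "nat \<Rightarrow> nat set" where
  "labels m = (if 4 dvd m then {1..m} else {1..m - 1} \<union> {m + 1})"

definition signable :: "nat set \<Rightarrow> bool" where
  "signable B \<longleftrightarrow> (\<exists>\<sigma> :: nat \<Rightarrow> int. (\<forall>k. \<bar>\<sigma> k\<bar> = 1) \<and> (\<Sum>k\<in>B. \<sigma> k * int k) = 0)"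

lemma finite_labels [simp]: "finite (labels m)"
  by (simp add: labels_def)

lemma card_labels: "even m \<Longrightarrow> card (labels m) = m"
  by (cases m) (auto simp: labels_def)

lemma labels_pos: "k \<in> labels m \<Longrightarrow> k > 0"
  by (auto simp: labels_def split: if_splits)

text \<open>All elements of \<open>labels k\<close> are at most \<open>k + 1\<close>, and distinct
  even numbers differ by at least 2, so \<open>labels k\<close> stays below the possible gap at
  \<open>m\<close>.\<close>

lemma labels_mono:
  assumes "even k" "even m" "k \<le> m"
  shows "labels k \<subseteq> labels m"
proof (cases "k = m")
  case False
  with assms have "k + 2 \<le> m" by presburger
  then show ?thesis by (auto simp: labels_def)
qed simp

lemma signableI:
  assumes "finite P" "finite N" "P \<inter> N = {}" "\<Sum>P = \<Sum>N"
  shows "signable (P \<union> N)"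
proof -
  let ?\<sigma> = "\<lambda>k. if k \<in> P then 1 else - 1 :: int"
  have "(\<Sum>k\<in>P \<union> N. ?\<sigma> k * int k) = (\<Sum>k\<in>P. ?\<sigma> k * int k) + (\<Sum>k\<in>N. ?\<sigma> k * int k)"
    using assms by (intro sum.union_disjoint) auto
  also have "(\<Sum>k\<in>P. ?\<sigma> k * int k) = int (\<Sum>P)"
    by simp
  also have "(\<Sum>k\<in>N. ?\<sigma> k * int k) = (\<Sum>k\<in>N. - int k)"
    using assms by (intro sum.cong) auto
  also have "\<dots> = - int (\<Sum>N)"
    by (simp add: sum_negf)
  finally show ?thesis
    unfolding signable_def using assms by (intro exI[of _ ?\<sigma>]) auto
qed

lemma signable_Un:
  assumes "signable A" "signable B" "finite A" "finite B" "A \<inter> B = {}"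
  shows "signable (A \<union> B)"
proof -
  obtain \<sigma> \<tau> :: "nat \<Rightarrow> int" where *: "\<forall>k. \<bar>\<sigma> k\<bar> = 1" "(\<Sum>k\<in>A. \<sigma> k * int k) = 0"
    "\<forall>k. \<bar>\<tau> k\<bar> = 1" "(\<Sum>k\<in>B. \<tau> k * int k) = 0"
    using assms unfolding signable_def by blast
  let ?\<rho> = "\<lambda>k. if k \<in> A then \<sigma> k else \<tau> k"
  have "(\<Sum>k\<in>A \<union> B. ?\<rho> k * int k) = (\<Sum>k\<in>A. ?\<rho> k * int k) + (\<Sum>k\<in>B. ?\<rho> k * int k)"
    using assms by (intro sum.union_disjoint) auto
  also have "(\<Sum>k\<in>B. ?\<rho> k * int k) = (\<Sum>k\<in>B. \<tau> k * int k)"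
    using assms by (intro sum.cong) auto
  finally have "(\<Sum>k\<in>A \<union> B. ?\<rho> k * int k) = 0"
    using * by simp
  then show ?thesis
    unfolding signable_def using * by (intro exI[of _ ?\<rho>]) auto
qed

text \<open>For \<open>4 dvd m\<close> the block consists of four consecutive numbers; otherwise it
  fills the gap \<open>m\<close> and leaves a new one at \<open>m + 4\<close>. In both cases the
  outer pair and the inner pair have equal sums.\<close>

lemma signable_labels_diff_4:
  assumes "even m"
  shows "signable (labels (m + 4) - labels m)"
proof (cases "4 dvd m")
  case True
  then have "labels (m + 4) - labels m = {m + 1, m + 4} \<union> {m + 2, m + 3}"
    unfolding labels_def by auto
  then show ?thesis by (simp only:) (rule signableI; simp)
next
  case False
  with assms have "m \<ge> 2" by presburger
  with False have "labels (m + 4) - labels m = {m, m + 5} \<union> {m + 2, m + 3}"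
    unfolding labels_def by auto
  then show ?thesis by (simp only:) (rule signableI; simp)
qed

text \<open>Adding 6 changes the residue modulo 4, so either a new gap appears at
  \<open>m + 6\<close> or the old one at \<open>m\<close> is filled. The triples sum to
  \<open>3 * m + 11\<close> and \<open>3 * m + 10\<close> respectively.\<close>

lemma signable_labels_diff_6:
  assumes "even m"
  shows "signable (labels (m + 6) - labels m)"
proof (cases "4 dvd m")
  case True
  then have "\<not> 4 dvd m + 6" by presburger
  with True have "labels (m + 6) - labels m = {m + 1, m + 3, m + 7} \<union> {m + 2, m + 4, m + 5}"
    unfolding labels_def by auto
  then show ?thesis by (simp only:) (rule signableI; simp)
next
  case False
  with assms have "m \<ge> 2" "4 dvd m + 6" by presburger+
  with False have "labels (m + 6) - labels m = {m, m + 4, m + 6} \<union> {m + 2, m + 3, m + 5}"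
    unfolding labels_def by auto
  then show ?thesis by (simp only:) (rule signableI; simp)
qed

text \<open>Blocks of size 4 are split off at the bottom, which moves \<open>m\<close>; stopping at
  4 and 6 avoids a rest of size 2.\<close>

lemma signable_labels_diff:
  assumes "even m" "even n" "n \<ge> 4"
  shows "signable (labels (m + n) - labels m)"
  using assms
proof (induction n arbitrary: m rule: less_induct)
  case (less n)
  have "n = 4 \<or> n = 6 \<or> n \<ge> 8"
    using less.prems by presburger
  then consider "n = 4" | "n = 6" | "n \<ge> 8"
    by blast
  then show ?case
  proof cases
    case 3
    define k where "k = n - 4"
    have k: "n = 4 + k" "k \<ge> 4" "even k"
      using 3 less.prems by (auto simp: k_def)
    have "signable (labels (m + 4 + k) - labels (m + 4))"
      using less.IH[of k "m + 4"] less.prems k by simp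
    moreover have "labels m \<subseteq> labels (m + 4)" "labels (m + 4) \<subseteq> labels (m + 4 + k)"
      using less.prems k by (intro labels_mono; simp)+
    then have "labels (m + n) - labels m =
        (labels (m + 4) - labels m) \<union> (labels (m + 4 + k) - labels (m + 4))"
      using k by (auto simp: add.assoc)
    ultimately show ?thesis
      using signable_labels_diff_4[of m] less.prems by (auto intro!: signable_Un)
  qed (use less.prems signable_labels_diff_4 signable_labels_diff_6 in auto)
qed

section \<open>Blocks of labels, one for each star\<close>

text \<open>The stars are stacked from the last one to the first, so that blocks recurse over the list.\<close>

definition block :: "nat list \<Rightarrow> nat \<Rightarrow> nat set" where
  "block ns i = labels (sum_list (drop i ns)) - labels (sum_list (drop (Suc i) ns))"

lemma block_Cons_0: "block (n # ns) 0 = labels (n + sum_list ns) - labels (sum_list ns)"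
  by (simp add: block_def)

lemma block_Cons_Suc [simp]: "block (n # ns) (Suc i) = block ns i"
  by (simp add: block_def)

lemma finite_block [simp]: "finite (block ns i)"
  by (simp add: block_def)

lemma even_sum_list: "\<forall>n\<in>set ns. even n \<Longrightarrow> even (sum_list ns)" for ns :: "nat list"
  by (induction ns) auto

lemma
  assumes "\<forall>n\<in>set ns. even n \<and> n \<ge> 4" "i < length ns"
  shows signable_block: "signable (block ns i)"
    and card_block: "card (block ns i) = ns ! i"
proof -
  let ?m = "sum_list (drop (Suc i) ns)"
  have m: "even ?m"
    using assms by (intro even_sum_list) (meson in_set_dropD)
  have n: "even (ns ! i)" "ns ! i \<ge> 4"
    using assms by auto
  have "block ns i = labels (?m + ns ! i) - labels ?m"
    using assms(2) by (simp add: block_def Cons_nth_drop_Suc[symmetric] add.commute)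
  then show "signable (block ns i)" "card (block ns i) = ns ! i"
    using signable_labels_diff[OF m n] m n card_labels[of ?m] card_labels[of "?m + ns ! i"]
      labels_mono[of ?m "?m + ns ! i"]
    by (simp_all add: card_Diff_subset)
qed

text \<open>The differences telescope: the label sets are nested and \<open>labels 0\<close> is
  empty.\<close>

lemma UN_block: 
  assumes "\<forall>n\<in>set ns. even n"
  shows "(\<Union>i<length ns. block ns i) = labels (sum_list ns)"
  using assms
proof (induction ns)
  case (Cons n ns)
  have "(\<Union>i<length (n # ns). block (n # ns) i) = block (n # ns) 0 \<union> (\<Union>i<length ns. block ns i)"
    by (simp add: lessThan_Suc_eq_insert_0 image_image)
  moreover have "labels (sum_list ns) \<subseteq> labels (n + sum_list ns)"
    using Cons.prems even_sum_list[of ns] by (intro labels_mono) auto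
  ultimately show ?case
    using Cons by (auto simp: block_Cons_0)
qed (simp add: labels_def)

text \<open>The later block lies within the label set that is removed to form the earlier
  one.\<close>

lemma disjoint_block:
  assumes "\<forall>n\<in>set ns. even n" "i < j"
  shows "block ns i \<inter> block ns j = {}"
proof -
  have "sum_list (drop j ns) \<le> sum_list (drop (Suc i) ns)"
    using assms(2) by (metis Suc_leI append_take_drop_id drop_drop le_add2 le_add_diff_inverse2 sum_list_append)
  moreover have "even (sum_list (drop k ns))" for k
    using assms(1) by (intro even_sum_list) (meson in_set_dropD)
  ultimately have "labels (sum_list (drop j ns)) \<subseteq> labels (sum_list (drop (Suc i) ns))"
    by (intro labels_mono) auto
  then show ?thesis by (auto simp: block_def)
qed

section \<open>Sums attainable at the center\<close>

text \<open>Here \<open>t i\<close> is the signed label of the edge that joins star \<open>i\<close>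
  to the center. Only its absolute value is tied to the block, because all signs of a star may be
  reversed together.\<close>

definition center_sum :: "nat list \<Rightarrow> int \<Rightarrow> bool" where
  "center_sum ns d \<longleftrightarrow> (\<exists>t. (\<forall>i<length ns. nat \<bar>t i\<bar> \<in> block ns i) \<and> (\<Sum>i<length ns. t i) = d)"

lemma center_sum_Nil: "center_sum [] 0"
  by (simp add: center_sum_def)

lemma center_sum_Cons:
  assumes "center_sum ns d" "nat \<bar>a\<bar> \<in> block (n # ns) 0"
  shows "center_sum (n # ns) (a + d)"
proof -
  obtain t where "\<forall>i<length ns. nat \<bar>t i\<bar> \<in> block ns i" "(\<Sum>i<length ns. t i) = d"
    using assms unfolding center_sum_def by blast
  with assms(2) show ?thesis
    unfolding center_sum_def
    by (intro exI[of _ "case_nat a t"])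
       (auto simp: sum.lessThan_Suc_shift less_Suc_eq_0_disj simp del: sum.lessThan_Suc)
qed

text \<open>The witnesses lie around the border \<open>k\<close> between the two blocks.\<close>

lemma block_differences:
  assumes "even (sum_list ns)" "even n" "n \<ge> 4" "even n'" "n' \<ge> 4" "\<delta> \<in> {1, 2}"
  shows "\<exists>a\<in>block (n' # n # ns) 0. \<exists>b\<in>block (n # ns) 0. \<bar>int a - int b\<bar> = \<delta>"
proof -
  define k where "k = n + sum_list ns"
  have k: "even k" "sum_list ns + 4 \<le> k"
    using assms by (auto simp: k_def)
  have blocks: "block (n' # n # ns) 0 = labels (n' + k) - labels k"
      "block (n # ns) 0 = labels k - labels (sum_list ns)"
    by (simp_all add: block_Cons_0 k_def)
  show ?thesis
  proof (cases "4 dvd k")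
    case True
    \<comment> \<open>The lower block ends at \<open>k\<close>; the upper one starts with
      \<open>k + 1\<close> and \<open>k + 2\<close>.\<close>
    then have "k + nat \<delta> \<in> block (n' # n # ns) 0" "k \<in> block (n # ns) 0"
      using k assms unfolding blocks by (auto simp: labels_def)
    moreover have "\<bar>int (k + nat \<delta>) - int k\<bar> = \<delta>"
      using assms by auto
    ultimately show ?thesis by blast
  next
    case False
    \<comment> \<open>The gap \<open>k\<close> of \<open>labels k\<close> goes to the upper block.
      The lower star has at least four edges, so \<open>k - 2\<close> is above all of
      \<open>labels (sum_list ns)\<close>.\<close>
    then have "k \<in> block (n' # n # ns) 0" "k + 1 \<in> block (n # ns) 0" "k - 2 \<in> block (n # ns) 0"
      using k assms unfolding blocks by (auto simp: labels_def)
    moreover have "\<bar>int k - int (k + 1)\<bar> = 1" "\<bar>int k - int (k - 2)\<bar> = 2"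
      using k by auto
    ultimately show ?thesis
      using assms(6) by blast
  qed
qed

lemma center_sum_Cons2:
  assumes "center_sum ns d" "even (sum_list ns)" "even n" "n \<ge> 4" "even n'" "n' \<ge> 4" "\<bar>\<delta>\<bar> \<in> {1, 2}"
  shows "center_sum (n' # n # ns) (d + \<delta>)"
proof -
  obtain a b where ab: "a \<in> block (n' # n # ns) 0" "b \<in> block (n # ns) 0" "\<bar>int a - int b\<bar> = \<bar>\<delta>\<bar>"
    using block_differences[OF assms(2-7)] by blast
  \<comment> \<open>The two edges at the center get opposite signs, so the pair contributes
    \<open>a - b\<close> or \<open>b - a\<close>.\<close>
  have step: "center_sum (n' # n # ns) (\<epsilon> * int a + (- \<epsilon> * int b + d))" if "\<bar>\<epsilon>\<bar> = 1" for \<epsilon>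
    using assms(1) ab that by (intro center_sum_Cons) (auto simp: abs_mult)
  have "d + \<delta> = 1 * int a + (- 1 * int b + d) \<or> d + \<delta> = (-1) * int a + (- (- 1) * int b + d)"
    using ab(3) by linarith
  then show ?thesis using step[of 1] step[of "-1"] by (elim disjE) (simp_all only:)
qed

text \<open>Both values are carried through the induction, since a further pair of stars gives 1 as
  \<open>2 - 1\<close> and 2 as \<open>1 + 1\<close>.\<close>

lemma center_sum_1_2:
  assumes "\<forall>n\<in>set ns. even n \<and> n \<ge> 4" "ns \<noteq> []"
  shows "center_sum ns 1 \<and> center_sum ns 2"
  using assms
proof (induction ns rule: induct_list012)
  case (2 n)
  \<comment> \<open>The only block is \<open>labels n\<close>, which contains 1 and 2 because
    \<open>n \<ge> 4\<close>.\<close>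
  then have "nat \<bar>1\<bar> \<in> block [n] 0" "nat \<bar>2\<bar> \<in> block [n] 0"
    by (auto simp: block_def labels_def)
  then show ?case
    using center_sum_Cons[OF center_sum_Nil] by (metis add.right_neutral)
next
  case (3 n' n ns)
  have *: "center_sum (n' # n # ns) (d + \<delta>)" if "center_sum ns d" "\<bar>\<delta>\<bar> \<in> {1, 2}" for d \<delta>
    using that 3 even_sum_list[of ns] by (intro center_sum_Cons2) auto
  show ?case
  proof (cases "ns = []")
    case True
    then show ?thesis using *[of 0 1] *[of 0 2] center_sum_Nil by simp
  next
    case False
    then have "center_sum ns 1" "center_sum ns 2" using 3 by auto
    then show ?thesis using *[of 2 "-1"] *[of 1 1] by simp
  qed
qed simp

text \<open>The first two stars contribute -1 and the others 1. One or two stars could not give 0,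
  as their labels are positive and come from disjoint blocks.\<close>

lemma center_sum_0:
  assumes "\<forall>n\<in>set ns. even n \<and> n \<ge> 4" "length ns \<ge> 3"
  shows "center_sum ns 0"
proof -
  obtain n' n ns' where ns: "ns = n' # n # ns'" "ns' \<noteq> []"
    using assms(2) by (metis One_nat_def Suc_le_length_iff length_0_conv numeral_3_eq_3 not_less_eq_eq le_zero_eq zero_le)
  then have "center_sum ns' 1" using assms center_sum_1_2[of ns'] by auto
  then show ?thesis
    using center_sum_Cons2[of ns' 1 n n' "-1"] assms ns even_sum_list[of ns'] by auto
qed

section \<open>Signed labels on the edges of all stars\<close>

text \<open>Reversing all signs if necessary gives \<open>\<bar>t\<bar>\<close> the sign of
  \<open>t\<close>, and a transposition of indices moves it to position \<open>l\<close>; neither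
  affects the zero sum.\<close>

lemma signed_labels_of_block:
  assumes "signable B" "finite B" "0 \<notin> B" "nat \<bar>t\<bar> \<in> B" "l \<in> {1..card B}"
  shows "\<exists>w :: nat \<Rightarrow> int. bij_betw (\<lambda>j. nat \<bar>w j\<bar>) {1..card B} B \<and>
    (\<Sum>j=1..card B. w j) = 0 \<and> w l = t"
proof -
  obtain \<sigma> :: "nat \<Rightarrow> int" where \<sigma>: "\<forall>k. \<bar>\<sigma> k\<bar> = 1" "(\<Sum>k\<in>B. \<sigma> k * int k) = 0"
    using assms unfolding signable_def by blast
  define \<epsilon> where "\<epsilon> = \<sigma> (nat \<bar>t\<bar>) * sgn t"
  have t: "t \<noteq> 0" using assms by auto
  then have \<epsilon>: "\<bar>\<epsilon>\<bar> = 1"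
    using \<sigma> by (simp add: \<epsilon>_def abs_mult)
  obtain f where f: "bij_betw f {1..card B} B"
    using assms(2) by (metis card_atLeastAtMost diff_Suc_1 finite_atLeastAtMost finite_same_card_bij)
  then obtain m where m: "m \<in> {1..card B}" "f m = nat \<bar>t\<bar>"
    using assms(4) by (metis bij_betw_imp_surj_on imageE)
  define g where "g = f \<circ> transpose l m"
  have g: "bij_betw g {1..card B} B" "g l = nat \<bar>t\<bar>"
    using f m assms(5) by (auto simp: g_def intro!: bij_betw_trans)
  define w where "w j = \<epsilon> * \<sigma> (g j) * int (g j)" for j
  have "nat \<bar>w j\<bar> = g j" for j
    using \<epsilon> \<sigma> by (simp add: w_def abs_mult)
  moreover have "(\<Sum>j=1..card B. w j) = (\<Sum>k\<in>B. \<epsilon> * (\<sigma> k * int k))"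
    using sum.reindex_bij_betw[OF g(1), of "\<lambda>k. \<epsilon> * (\<sigma> k * int k)"] by (simp add: w_def mult.assoc)
  then have "(\<Sum>j=1..card B. w j) = 0"
    using \<sigma> by (simp flip: sum_distrib_left)
  moreover have "w l = (\<sigma> (nat \<bar>t\<bar>) * \<sigma> (nat \<bar>t\<bar>)) * (sgn t * \<bar>t\<bar>)"
    by (simp add: w_def \<epsilon>_def g(2) algebra_simps)
  then have "w l = t"
    using \<sigma>(1) by (metis abs_mult_self_eq mult_1 mult_sgn_abs mult.commute)
  ultimately show ?thesis using g by (intro exI[of _ w]) simp
qed


abbreviation star_edges :: "nat list \<Rightarrow> (nat \<times> nat) set" where
  "star_edges ns \<equiv> SIGMA i:{..<length ns}. {1..ns ! i}"

lemma image_Sigma_eq_UN: "(\<lambda>(i, j). f i j) ` Sigma A B = (\<Union>i\<in>A. f i ` B i)"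
  by force

lemma signed_labels_exist:
  assumes ns: "\<forall>n\<in>set ns. even n \<and> n \<ge> 4" and l: "\<forall>i<length ns. l i \<in> {1..ns ! i}"
  shows "\<exists>w :: nat \<Rightarrow> nat \<Rightarrow> int.
    bij_betw (\<lambda>(i, j). nat \<bar>w i j\<bar>) (star_edges ns) (labels (sum_list ns)) \<and>
    (\<forall>i<length ns. (\<Sum>j=1..ns ! i. w i j) = 0) \<and>
    (length ns \<ge> 3 \<longrightarrow> (\<Sum>i<length ns. w i (l i)) = 0)"
proof -
  \<comment> \<open>With fewer than three stars no sum is prescribed at the center, so any
    attainable value will do.\<close>
  have "\<exists>d. center_sum ns d \<and> (length ns \<ge> 3 \<longrightarrow> d = 0)"
    using center_sum_0[OF ns] center_sum_1_2[OF ns] center_sum_Nil by (cases "ns = []") auto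
  then obtain t where t: "\<forall>i<length ns. nat \<bar>t i\<bar> \<in> block ns i"
      "length ns \<ge> 3 \<longrightarrow> (\<Sum>i<length ns. t i) = 0"
    unfolding center_sum_def by blast
  have "\<exists>w :: nat \<Rightarrow> int. bij_betw (\<lambda>j. nat \<bar>w j\<bar>) {1..ns ! i} (block ns i) \<and>
      (\<Sum>j=1..ns ! i. w j) = 0 \<and> w (l i) = t i" if i: "i < length ns" for i
    using signed_labels_of_block[OF signable_block[OF ns i] finite_block, of "t i" "l i"]
      t(1) l i card_block[OF ns i] labels_pos[of 0]
    by (auto simp: block_def)
  then obtain w :: "nat \<Rightarrow> nat \<Rightarrow> int" where
    w: "\<And>i. i < length ns \<Longrightarrow> bij_betw (\<lambda>j. nat \<bar>w i j\<bar>) {1..ns ! i} (block ns i)"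
      "\<And>i. i < length ns \<Longrightarrow> (\<Sum>j=1..ns ! i. w i j) = 0"
      "\<And>i. i < length ns \<Longrightarrow> w i (l i) = t i"
    by metis
  have mem: "nat \<bar>w i j\<bar> \<in> block ns i" if "i < length ns" "j \<in> {1..ns ! i}" for i j
    using w(1)[OF that(1)] that(2) by (rule bij_betwE[rule_format])
  have "inj_on (\<lambda>(i, j). nat \<bar>w i j\<bar>) (star_edges ns)"
  proof (intro inj_onI, clarify)
    fix i j i' j'
    assume *: "i < length ns" "j \<in> {1..ns ! i}" "i' < length ns" "j' \<in> {1..ns ! i'}"
      "nat \<bar>w i j\<bar> = nat \<bar>w i' j'\<bar>"
    have "block ns i \<inter> block ns i' \<noteq> {}"
      using mem[OF *(1,2)] mem[OF *(3,4)] *(5) by auto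
    then have "i = i'"
      using disjoint_block[of ns i i'] disjoint_block[of ns i' i] ns
      by (metis Int_commute linorder_neqE_nat)
    moreover from this have "j = j'"
      using bij_betw_imp_inj_on[OF w(1)[OF *(1)]] * by (auto dest: inj_onD)
    ultimately show "i = i' \<and> j = j'" by simp
  qed
  moreover have "(\<lambda>(i, j). nat \<bar>w i j\<bar>) ` star_edges ns = labels (sum_list ns)"
    using bij_betw_imp_surj_on[OF w(1)] UN_block[of ns] ns
    by (simp add: image_Sigma_eq_UN del: One_nat_def)
  ultimately show ?thesis
    using w t by (intro exI[of _ w]) (auto simp: bij_betw_def)
qed

section \<open>Vertex sums as signed sums over neighbours\<close>

text \<open>Exactly one of the two arcs on each edge is chosen, so the two sums merge into one, in
  which a numbering of the neighbours can be substituted.\<close>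

lemma vertex_sum_eq_sum_neighbours:
  assumes D: "orientation G D" and fin: "finite {v. {u, v} \<in> edges G}"
  shows "vertex_sum D \<phi> u =
    (\<Sum>v | {u, v} \<in> edges G. if (v, u) \<in> D then int (\<phi> {u, v}) else - int (\<phi> {u, v}))"
proof -
  let ?N = "{v. {u, v} \<in> edges G}"
  have arc: "{a, b} \<in> edges G" if "(a, b) \<in> D" for a b
    using D that unfolding orientation_def by blast
  have xor: "(u, v) \<in> D \<longleftrightarrow> (v, u) \<notin> D" if "v \<in> ?N" for v
    using D that unfolding orientation_def by blast
  have sym: "{v, u} = {u, v}" for v
    by blast
  have "?N \<inter> {v. (v, u) \<in> D} = {v. (v, u) \<in> D}"
    using arc[of _ u] unfolding sym by blast
  moreover have "?N \<inter> - {v. (v, u) \<in> D} = {v. (u, v) \<in> D}"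
    using arc[of u] xor by blast
  ultimately show ?thesis
    unfolding vertex_sum_def sum.If_cases[OF fin] by (simp add: sum_negf sym)
qed

section \<open>Hubs, leaves and center of a snowflake\<close>

text \<open>\<open>h i\<close> is the hub of the \<open>i\<close>-th star and \<open>x i j\<close> its \<open>j\<close>-th neighbour, of which the \<open>l i\<close>-th is the center.\<close>

locale snowflake_graph =
  fixes G :: "'a sgraph" and z :: 'a and ns :: "nat list" and l :: "nat \<Rightarrow> nat"
    and h :: "nat \<Rightarrow> 'a" and x :: "nat \<Rightarrow> nat \<Rightarrow> 'a"
  assumes l: "i < length ns \<Longrightarrow> l i \<in> {1..ns ! i}"
    and vertices_eq: "vertices G = h ` {..<length ns} \<union> (\<lambda>(i, j). x i j) ` star_edges ns"
    and edges_eq: "edges G = (\<lambda>(i, j). {h i, x i j}) ` star_edges ns"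
    and inj_h: "inj_on h {..<length ns}"
    and x_neq_h: "(i, j) \<in> star_edges ns \<Longrightarrow> i' < length ns \<Longrightarrow> x i j \<noteq> h i'"
    and x_eq_center: "(i, j) \<in> star_edges ns \<Longrightarrow> x i j = z \<longleftrightarrow> j = l i"
    and inj_x: "\<lbrakk>(i, j) \<in> star_edges ns; (i', j') \<in> star_edges ns; x i j = x i' j'; x i j \<noteq> z\<rbrakk>
      \<Longrightarrow> i = i' \<and> j = j'"
begin

lemma x_center: "i < length ns \<Longrightarrow> x i (l i) = z"
  using x_eq_center l by auto

lemma center_neq_h: "i < length ns \<Longrightarrow> i' < length ns \<Longrightarrow> z \<noteq> h i'"
  using x_neq_h[of i "l i" i'] x_center l by auto

text \<open>Within star \<open>i\<close> only the index \<open>l i\<close> leads to the center;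
  elsewhere \<open>inj_x\<close> applies.\<close>

lemma inj_x_star: "i < length ns \<Longrightarrow> inj_on (x i) {1..ns ! i}"
proof (rule inj_onI)
  fix j j' assume *: "i < length ns" "j \<in> {1..ns ! i}" "j' \<in> {1..ns ! i}" "x i j = x i j'"
  then show "j = j'"
    using inj_x[of i j i j'] x_eq_center[of i j] x_eq_center[of i j'] by auto
qed

text \<open>No \<open>x i j\<close> is a hub, so the hub end of an edge is recognizable; it
  determines the star, and then the other end determines \<open>j\<close>.\<close>

lemma inj_star_edges: "inj_on (\<lambda>(i, j). {h i, x i j}) (star_edges ns)"
proof (rule inj_onI, clarify)
  fix i j i' j'
  assume *: "i < length ns" "j \<in> {1..ns ! i}" "i' < length ns" "j' \<in> {1..ns ! i'}"
    "{h i, x i j} = {h i', x i' j'}"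
  then have "h i = h i'" "x i j = x i' j'"
    using x_neq_h[of i' j' i] by (auto simp: doubleton_eq_iff)
  then show "i = i' \<and> j = j'"
    using * inj_onD[OF inj_h] inj_onD[OF inj_x_star[of i], of j j'] by auto
qed

lemma card_edges: "card (edges G) = sum_list ns"
  unfolding edges_eq card_image[OF inj_star_edges]
  by (simp add: card_SigmaI sum_list_sum_nth atLeast0LessThan)

lemma finite_edges: "finite (edges G)"
  unfolding edges_eq by simp

lemma edge_iff:
  "{u, v} \<in> edges G \<longleftrightarrow> (\<exists>(i, j)\<in>star_edges ns. u = h i \<and> v = x i j \<or> v = h i \<and> u = x i j)"
proof -
  have "{u, v} = {a, b} \<longleftrightarrow> u = a \<and> v = b \<or> v = a \<and> u = b" for a b
    by (auto simp: doubleton_eq_iff)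
  then show ?thesis
    by (simp add: edges_eq image_iff case_prod_unfold)
qed

lemma edge_h_x:
  assumes "(i, j) \<in> star_edges ns"
  shows "{h i, x i j} \<in> edges G" "{x i j, h i} \<in> edges G"
proof -
  show "{h i, x i j} \<in> edges G"
    using imageI[OF assms, of "\<lambda>(i, j). {h i, x i j}"] by (simp add: edges_eq)
  then show "{x i j, h i} \<in> edges G"
    by (simp only: insert_commute)
qed

lemma neighbours_h:
  assumes "i < length ns"
  shows "{v. {h i, v} \<in> edges G} = x i ` {1..ns ! i}"
proof (intro equalityI subsetI)
  fix v assume "v \<in> {v. {h i, v} \<in> edges G}"
  then obtain i' j' where *: "(i', j') \<in> star_edges ns"
      "h i = h i' \<and> v = x i' j' \<or> v = h i' \<and> h i = x i' j'"
    unfolding edge_iff by auto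
  then have "v = x i' j'" "i = i'"
    using x_neq_h[OF *(1) assms] inj_onD[OF inj_h, of i i'] assms by auto
  then show "v \<in> x i ` {1..ns ! i}" using *(1) by auto
qed (use assms edge_h_x in auto)

lemma neighbours_center:
  assumes "ns \<noteq> []"
  shows "{v. {z, v} \<in> edges G} = h ` {..<length ns}"
proof (intro equalityI subsetI)
  fix v assume "v \<in> {v. {z, v} \<in> edges G}"
  then obtain i j where *: "(i, j) \<in> star_edges ns" "z = h i \<and> v = x i j \<or> v = h i \<and> z = x i j"
    unfolding edge_iff by auto
  then show "v \<in> h ` {..<length ns}"
    using center_neq_h[of i i] by auto
next
  fix v assume "v \<in> h ` {..<length ns}"
  then obtain i where "i < length ns" "v = h i" by auto
  then show "v \<in> {v. {z, v} \<in> edges G}"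
    using x_center[of i] l[of i] edge_h_x(2)[of i "l i"] by auto
qed

lemma neighbours_leaf:
  assumes "(i, j) \<in> star_edges ns" "x i j \<noteq> z"
  shows "{v. {x i j, v} \<in> edges G} = {h i}"
proof (intro equalityI subsetI)
  fix v assume "v \<in> {v. {x i j, v} \<in> edges G}"
  then obtain i' j' where *: "(i', j') \<in> star_edges ns"
      "x i j = h i' \<and> v = x i' j' \<or> v = h i' \<and> x i j = x i' j'"
    unfolding edge_iff by auto
  then show "v \<in> {h i}"
    using x_neq_h[OF assms(1), of i'] inj_x[OF assms(1) *(1) _ assms(2)] by auto
qed (use assms edge_h_x in auto)

lemma degree_eq: "degree G u = card {v. {u, v} \<in> edges G}"
proof -
  have "{e \<in> edges G. u \<in> e} = (\<lambda>v. {u, v}) ` {v. {u, v} \<in> edges G}"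
    unfolding edges_eq by (auto simp: insert_commute)
  moreover have "inj_on (\<lambda>v. {u, v}) A" for A
    by (auto simp: inj_on_def doubleton_eq_iff)
  ultimately show ?thesis
    unfolding degree_def by (simp add: card_image)
qed

lemma degree_h: "i < length ns \<Longrightarrow> degree G (h i) = ns ! i"
  by (simp add: degree_eq neighbours_h card_image inj_x_star del: One_nat_def)

lemma degree_center: "ns \<noteq> [] \<Longrightarrow> degree G z = length ns"
  by (simp add: degree_eq neighbours_center card_image inj_h)

lemma vertex_sum_h:
  assumes "orientation G D" "i < length ns"
  shows "vertex_sum D \<phi> (h i) = (\<Sum>j=1..ns ! i.
    if (x i j, h i) \<in> D then int (\<phi> {h i, x i j}) else - int (\<phi> {h i, x i j}))"
  using assms
  by (simp add: vertex_sum_eq_sum_neighbours neighbours_h sum.reindex inj_x_star del: One_nat_def)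

lemma vertex_sum_center:
  assumes "orientation G D" "ns \<noteq> []"
  shows "vertex_sum D \<phi> z = (\<Sum>i<length ns.
    if (h i, z) \<in> D then int (\<phi> {h i, z}) else - int (\<phi> {h i, z}))"
proof -
  have "vertex_sum D \<phi> z = (\<Sum>i<length ns.
      if (h i, z) \<in> D then int (\<phi> {z, h i}) else - int (\<phi> {z, h i}))"
    using assms
    by (simp add: vertex_sum_eq_sum_neighbours neighbours_center sum.reindex inj_h)
  then show ?thesis by (simp add: insert_commute cong: if_cong)
qed

section \<open>Parity of the label sum\<close>

text \<open>Hubs have degree at least 3 and hence vertex sum 0. Dropping signs preserves parity, and
  each edge lies at exactly one hub.\<close>

lemma even_sum_labels:
  assumes "\<And>i. i < length ns \<Longrightarrow> ns ! i \<ge> 3" "balanced_labeling G S D \<phi>"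
  shows "even (\<Sum>S)"
proof -
  have D: "orientation G D" and bij: "bij_betw \<phi> (edges G) S"
    and bal: "\<And>u. u \<in> vertices G \<Longrightarrow> degree G u \<ge> 3 \<Longrightarrow> vertex_sum D \<phi> u = 0"
    using assms(2) unfolding balanced_labeling_def labeling_def by auto
  have "even (\<Sum>j=1..ns ! i. \<phi> {h i, x i j})" if i: "i < length ns" for i
  proof -
    let ?s = "\<lambda>j. if (x i j, h i) \<in> D then int (\<phi> {h i, x i j}) else - int (\<phi> {h i, x i j})"
    have "(\<Sum>j=1..ns ! i. ?s j) = 0"
      using vertex_sum_h[OF D i] bal[of "h i"] i assms(1) degree_h vertices_eq by auto
    \<comment> \<open>Dropping the sign changes each term by 0 or by twice a label.\<close>
    moreover have "even ((\<Sum>j=1..ns ! i. int (\<phi> {h i, x i j})) - (\<Sum>j=1..ns ! i. ?s j))"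
      unfolding sum_subtractf[symmetric] by (intro dvd_sum) auto
    ultimately show ?thesis
      by (simp flip: of_nat_sum)
  qed
  then have "even (\<Sum>i<length ns. \<Sum>j=1..ns ! i. \<phi> {h i, x i j})"
    by (intro dvd_sum[of "{..<length ns}"]) simp
  also have "(\<Sum>i<length ns. \<Sum>j=1..ns ! i. \<phi> {h i, x i j}) = (\<Sum>(i, j)\<in>star_edges ns. \<phi> {h i, x i j})"
    by (rule sum.Sigma) auto
  also have "\<dots> = (\<Sum>e\<in>edges G. \<phi> e)"
    unfolding edges_eq sum.reindex[OF inj_star_edges] by (intro sum.cong) auto
  also have "\<dots> = \<Sum>S"
    using sum.reindex_bij_betw[OF bij, of "\<lambda>k. k"] .
  finally show ?thesis .
qed

section \<open>Labelings from signed labels\<close>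

lemma balanced_labeling_of_signed_labels:
  fixes w :: "nat \<Rightarrow> nat \<Rightarrow> int"
  assumes bij: "bij_betw (\<lambda>(i, j). nat \<bar>w i j\<bar>) (star_edges ns) S" and S: "\<forall>k\<in>S. k > 0"
    and hub: "\<forall>i<length ns. (\<Sum>j=1..ns ! i. w i j) = 0"
    and center: "length ns \<ge> 3 \<longrightarrow> (\<Sum>i<length ns. w i (l i)) = 0"
  shows "\<exists>D \<phi>. balanced_labeling G S D \<phi>"
proof -
  let ?E = "\<lambda>(i, j). {h i, x i j}"
  \<comment> \<open>Labels belong to edges, so the index pair is recovered by inverting the
    numbering of the edges.\<close>
  define \<phi> where "\<phi> = (\<lambda>(i, j). nat \<bar>w i j\<bar>) \<circ> inv_into (star_edges ns) ?E"
  \<comment> \<open>a positive sign means that the arc enters the hub\<close>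
  define D where "D = {(x i j, h i) | i j. (i, j) \<in> star_edges ns \<and> w i j > 0} \<union>
    {(h i, x i j) | i j. (i, j) \<in> star_edges ns \<and> \<not> w i j > 0}"
  have \<phi>: "\<phi> {h i, x i j} = nat \<bar>w i j\<bar>" if "(i, j) \<in> star_edges ns" for i j
    using inv_into_f_f[OF inj_star_edges that] by (simp add: \<phi>_def)
  have "bij_betw ?E (star_edges ns) (edges G)"
    unfolding edges_eq using inj_star_edges by (rule inj_on_imp_bij_betw)
  then have bij_\<phi>: "bij_betw \<phi> (edges G) S"
    unfolding \<phi>_def using bij by (blast intro: bij_betw_trans bij_betw_inv_into)
  have key: "i = i' \<and> j = j'" if "(i, j) \<in> star_edges ns" "(i', j') \<in> star_edges ns"
      "h i = h i'" "x i j = x i' j'" for i j i' j'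
    using inj_onD[OF inj_star_edges, of "(i, j)" "(i', j')"] that by auto
  have D_in: "(x i j, h i) \<in> D \<longleftrightarrow> w i j > 0" and D_out: "(h i, x i j) \<in> D \<longleftrightarrow> \<not> w i j > 0"
    if "(i, j) \<in> star_edges ns" for i j
    using that key[OF that] x_neq_h unfolding D_def by (auto; metis)+
  have D: "orientation G D"
    unfolding orientation_def
  proof (intro conjI allI impI)
    show "\<forall>(u, v)\<in>D. {u, v} \<in> edges G"
      using edge_h_x unfolding D_def by auto
    show "((u, v) \<in> D) \<noteq> ((v, u) \<in> D)" if uv: "{u, v} \<in> edges G" for u v
    proof -
      obtain i j where "(i, j) \<in> star_edges ns" "u = h i \<and> v = x i j \<or> v = h i \<and> u = x i j"
        using uv unfolding edge_iff by auto
      then show ?thesis using D_in D_out by metis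
    qed
  qed
  have "vertex_sum D \<phi> u = 0" if u: "u \<in> vertices G" "degree G u \<ge> 3" for u
  proof -
    \<comment> \<open>The third kind are the leaves of the snowflake; their degree is 1, contrary to
      \<open>degree G u \<ge> 3\<close>.\<close>
    consider i where "i < length ns" "u = h i" | "u = z" "ns \<noteq> []"
      | i j where "(i, j) \<in> star_edges ns" "u = x i j" "x i j \<noteq> z"
    proof -
      have "(\<exists>i<length ns. u = h i) \<or> (\<exists>(i, j)\<in>star_edges ns. u = x i j)"
        using u(1) unfolding vertices_eq by auto
      moreover have "ns \<noteq> []"
        using u(1) unfolding vertices_eq by auto
      ultimately show ?thesis using that by (cases "u = z") auto
    qed
    then show ?thesis
    proof cases
      case 1
      have "vertex_sum D \<phi> u = (\<Sum>j=1..ns ! i. w i j)"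
        unfolding 1(2) vertex_sum_h[OF D 1(1)]
        using 1(1) by (intro sum.cong) (auto simp: D_in \<phi>)
      then show ?thesis using hub 1 by simp
    next
      case 2
      \<comment> \<open>An arc that enters the hub leaves the center, hence the minus sign.\<close>
      have "vertex_sum D \<phi> u = (\<Sum>i<length ns. - w i (l i))"
        unfolding 2(1) vertex_sum_center[OF D 2(2)]
      proof (intro sum.cong refl)
        fix i assume "i \<in> {..<length ns}"
        then have i: "(i, l i) \<in> star_edges ns" "i < length ns" using l by auto
        show "(if (h i, z) \<in> D then int (\<phi> {h i, z}) else - int (\<phi> {h i, z})) = - w i (l i)"
          using D_out[OF i(1)] \<phi>[OF i(1)] x_center[OF i(2)] by auto
      qed
      then show ?thesis
        using center u(2) 2 degree_center by (simp add: sum_negf)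
    next
      case 3
      then show ?thesis
        using u(2) neighbours_leaf by (simp add: degree_eq)
    qed
  qed
  moreover have "card S = card (edges G)" "finite S"
    using bij_betw_same_card[OF bij_\<phi>] bij_betw_finite[OF bij_\<phi>] finite_edges by auto
  ultimately show ?thesis
    using D bij_\<phi> S unfolding balanced_labeling_def labeling_def by blast
qed

end

section \<open>Coordinates from the definition of a snowflake\<close>

lemma edges_star: "edges (star n) = (\<lambda>j. {0, j}) ` {1..n}"
  by (auto simp: star_def)

text \<open>The edges \<open>{0, 1}\<close> and \<open>{0, 2}\<close> keep the hub from being a
  leaf; for \<open>n = 1\<close> it would be one.\<close>

lemma is_leaf_starD:
  assumes "n \<ge> 2" "is_leaf (star n) v"
  shows "v \<in> {1..n}"
proof -
  have "v \<noteq> 0"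
  proof
    assume "v = 0"
    have "{{0, 1}, {0, 2}} \<subseteq> {e \<in> edges (star n). 0 \<in> e}"
      using assms(1) by (auto simp: star_def)
    then have "card {{0, 1}, {0, 2 :: nat}} \<le> card {e \<in> edges (star n). 0 \<in> e}"
      by (intro card_mono) (auto simp: star_def)
    then show False
      using assms(2) \<open>v = 0\<close> by (simp add: is_leaf_def degree_def doubleton_eq_iff)
  qed
  with assms(2) show ?thesis by (auto simp: is_leaf_def star_def)
qed

lemma snowflake_imp_snowflake_graph:
  assumes "snowflake G z"
  obtains ns l h x where "snowflake_graph G z ns l h x" "ns \<noteq> []" "\<And>i. i < length ns \<Longrightarrow> ns ! i \<ge> 3"
proof -
  obtain ns l q where ns: "ns \<noteq> []"
    and n: "\<forall>i < length ns. ns ! i \<ge> 3 \<and> is_leaf (star (ns ! i)) (l i)"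
    and q: "identification (disjoint_union (map star ns)) {(i, l i) | i. i < length ns} q G z"
    using assms unfolding snowflake_def by blast
  let ?H = "disjoint_union (map star ns)" and ?L = "{(i, l i) | i. i < length ns}"
  have VH: "vertices ?H = (SIGMA i:{..<length ns}. {0..ns ! i})"
    by (auto simp: disjoint_union_def star_def)
  have EH: "edges ?H = (\<lambda>(i, j). {(i, 0), (i, j)}) ` star_edges ns"
    by (simp add: disjoint_union_def edges_star image_Sigma_eq_UN image_image)
  have l: "l i \<in> {1..ns ! i}" if "i < length ns" for i
    using is_leaf_starD[of "ns ! i" "l i"] n that by force
  have V: "vertices G = q ` vertices ?H" and E: "edges G = (\<lambda>e. q ` e) ` edges ?H"
    and z: "\<And>v. v \<in> vertices ?H \<Longrightarrow> q v = z \<longleftrightarrow> v \<in> ?L"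
    and inj: "inj_on q (vertices ?H - ?L)"
    using q unfolding identification_def by blast+
  have z': "q (i, j) = z \<longleftrightarrow> j = l i" if "i < length ns" "j \<le> ns ! i" for i j
    using z[of "(i, j)"] that by (auto simp: VH)
  \<comment> \<open>A vertex not sent to the center is outside the identified leaves, where
    \<open>q\<close> is injective.\<close>
  have inj': "i = i' \<and> j = j'" if "i < length ns" "j \<le> ns ! i" "i' < length ns" "j' \<le> ns ! i'"
      "q (i, j) = q (i', j')" "q (i, j) \<noteq> z" for i j i' j'
    using inj_onD[OF inj, of "(i, j)" "(i', j')"] that z'[OF that(1,2)] z'[OF that(3,4)] by (auto simp: VH)
  \<comment> \<open>The leaf of a star that is identified is never its hub \<open>0\<close>.\<close>
  have hub: "q (i, 0) \<noteq> z" if "i < length ns" for i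
    using z'[of i 0] l that by force
  have "snowflake_graph G z ns l (\<lambda>i. q (i, 0)) (\<lambda>i j. q (i, j))"
  proof
    have "vertices ?H = (\<lambda>i. (i, 0)) ` {..<length ns} \<union> star_edges ns"
      unfolding VH by (auto simp: image_iff)
    then show "vertices G = (\<lambda>i. q (i, 0)) ` {..<length ns} \<union> (\<lambda>(i, j). q (i, j)) ` star_edges ns"
      unfolding V by (simp add: image_Un image_image)
    show "edges G = (\<lambda>(i, j). {q (i, 0), q (i, j)}) ` star_edges ns"
      unfolding E EH by (simp add: image_image case_prod_unfold)
    show "inj_on (\<lambda>i. q (i, 0)) {..<length ns}"
      using inj'[of _ 0 _ 0] hub by (simp add: inj_on_def)
    show "q (i, j) \<noteq> q (i', 0)" if "(i, j) \<in> star_edges ns" "i' < length ns" for i j i'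
      using inj'[of i' 0 i j] hub[of i'] that by auto
  qed (use l z' inj' in auto)
  then show ?thesis using that ns n by blast
qed

section \<open>The residue classes modulo 4\<close>

lemma odd_sum_atLeastAtMost:
  assumes "n mod 4 = 2"
  shows "odd (\<Sum>{1..n :: nat})"
proof -
  have "n = 4 * (n div 4) + 2" using assms by presburger
  then obtain k where n: "n = 4 * k + 2" by blast
  have "\<Sum>{1..n} = n * (n + 1) div 2"
    using Sum_Icc_nat[of 1 n] by simp
  also have "\<dots> = (2 * k + 1) * (4 * k + 3)"
    unfolding n by (simp add: algebra_simps)
  finally show ?thesis by simp
qed

theorem theorem29:
  fixes C :: "'a sgraph" and z :: 'a and M :: nat
  assumes "even_snowflake C z"
    and "M = card (edges C)"
  shows "(M mod 4 = 0 \<longrightarrow> conservative C) \<and> (M mod 4 \<noteq> 0 \<longrightarrow> near_conservative C)"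
proof -
  obtain ns l h x where G: "snowflake_graph C z ns l h x" and ns: "ns \<noteq> []"
    and n: "\<And>i. i < length ns \<Longrightarrow> ns ! i \<ge> 3"
    using assms(1) snowflake_imp_snowflake_graph unfolding even_snowflake_def by metis
  interpret snowflake_graph C z ns l h x by (rule G)
  have even: "even (ns ! i)" if i: "i < length ns" for i
  proof -
    \<comment> \<open>Evenness of the snowflake speaks of internal vertices other than the center,
      and hubs are such vertices.\<close>
    have "internal C (h i)" "h i \<noteq> z"
      using i n[OF i] degree_h center_neq_h[OF i i] vertices_eq by (auto simp: internal_def)
    then show ?thesis
      using assms(1) degree_h[OF i] unfolding even_snowflake_def by metis
  qed
  have ge4: "\<forall>n\<in>set ns. even n \<and> n \<ge> 4"
  proof
    fix m assume "m \<in> set ns"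
    then have "even m" "m \<ge> 3" using even n by (auto simp: in_set_conv_nth)
    then show "even m \<and> m \<ge> 4" by presburger
  qed
  have M: "M = sum_list ns" using assms(2) card_edges by simp
  have "even M" unfolding M using ge4 by (intro even_sum_list) auto
  \<comment> \<open>\<open>labels M\<close> is the required label set for either residue, so one
    labeling serves both cases.\<close>
  obtain D \<phi> where *: "balanced_labeling C (labels M) D \<phi>"
    using signed_labels_exist[OF ge4, of l] l balanced_labeling_of_signed_labels[of _ "labels M"]
      labels_pos unfolding M by blast
  show ?thesis
  proof (intro conjI impI)
    assume "M mod 4 = 0"
    then have "labels M = {1..M}" by (simp add: labels_def dvd_eq_mod_eq_0)
    then show "conservative C"
      using * assms(2) unfolding conservative_def conservative_labeling_def by auto
  next
    assume M4: "M mod 4 \<noteq> 0"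
    then have "labels M = {1..M - 1} \<union> {M + 1}" by (simp add: labels_def dvd_eq_mod_eq_0)
    then have "\<exists>D \<phi>. near_conservative_labeling C D \<phi>"
      using * assms(2) unfolding near_conservative_labeling_def by auto
    \<comment> \<open>As \<open>M\<close> is even, the residue can only be 2.\<close>
    moreover have "odd (\<Sum>{1..M})"
      using M4 \<open>even M\<close> by (intro odd_sum_atLeastAtMost) presburger
    then have "\<not> conservative C"
      using even_sum_labels[OF n] assms(2) unfolding conservative_def conservative_labeling_def by blast
    ultimately show "near_conservative C"
      unfolding near_conservative_def by blast
  qed
qed

end
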